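(* Let $\alpha,\beta\in\mathbb R_0^+$ with $\alpha+\beta\ne0$, let $f,g:\mathbb R\to\mathbb R$ and let $a,b\in\mathbb R$ with $a<b$ be such that $b\in\mathcal A:=\{a+k\alpha:k\in\mathbb N_0\}$ and $a\in\mathcal B:=\{b-k\beta:k\in\mathbb N_0\}$. If $f$ and $g$ are $\alpha,\beta$-symmetric integrable on $[a,b]$, then $$\int_a^b|f(t)g(t)|\,d_{\alpha,\beta}t\le\sqrt{\left(\int_a^b|f(t)|^2\,d_{\alpha,\beta}t\right)\left(\int_a^b|g(t)|^2\,d_{\alpha,\beta}t\right)}.$$
   Context: $\mathbb R_0^+=[0,\infty)$, $\mathbb N_0=\{0,1,2,\dots\}$. For $\alpha>0$, the $\alpha$-forward integral of $f:\mathbb R\to\mathbb R$ is $\int_a^bf(t)\Delta_\alpha t=\int_a^{+\infty}f(t)\Delta_\alpha t-\int_b^{+\infty}f(t)\Delta_\alpha t$, where $\int_x^{+\infty}f(t)\Delta_\alpha t=\alpha\sum_{k=0}^{+\infty}f(x+k\alpha)$; $f$ is $\alpha$-forward integrable on $[a,b]$ if the series converges at $x=a$ and $x=b$. For $\beta>0$, the $\beta$-backward integral is $\int_a^bf(t)\nabla_\beta t=\int_{-\infty}^bf(t)\nabla_\beta t-\int_{-\infty}^af(t)\nabla_\beta t$, where $\int_{-\infty}^xf(t)\nabla_\beta t=\beta\sum_{k=0}^{+\infty}f(x-k\beta)$; $f$ is $\beta$-backward integrable on $[a,b]$ if the series converges at $x=a$ and $x=b$. For $\alpha,\beta\ge0$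 with $\alpha+\beta>0$, $f$ is $\alpha,\beta$-symmetric integrable on $[a,b]$ if it is $\alpha$-forward and $\beta$-backward integrable on $[a,b]$ (if $\beta=0$ only the forward, if $\alpha=0$ only the backward integrability is required), and then $$\int_a^bf(t)\,d_{\alpha,\beta}t=\frac{\alpha}{\alpha+\beta}\int_a^bf(t)\Delta_\alpha t+\frac{\beta}{\alpha+\beta}\int_a^bf(t)\nabla_\beta t,$$ a term with coefficient $0$ being omitted.
   Formalization: It is additionally assumed that |f|² and |g|² are α,β-symmetric integrable on [a,b], since this does not follow from integrability of f and g and the right-hand side is otherwise undefined; integrability of |fg| is proved. *)

theory Defs
  imports Complex_Main
begin

definition forward_integrable :: "real \<Rightarrow> (real \<Rightarrow> real) \<Rightarrow> real \<Rightarrow> real \<Rightarrow> bool" where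
  "forward_integrable \<alpha> f a b \<longleftrightarrow>
     summable (\<lambda>k. f (a + real k * \<alpha>)) \<and> summable (\<lambda>k. f (b + real k * \<alpha>))"

definition forward_tail :: "real \<Rightarrow> (real \<Rightarrow> real) \<Rightarrow> real \<Rightarrow> real" where
  "forward_tail \<alpha> f x = \<alpha> * (\<Sum>k. f (x + real k * \<alpha>))"

definition forward_integral :: "real \<Rightarrow> (real \<Rightarrow> real) \<Rightarrow> real \<Rightarrow> real \<Rightarrow> real" where
  "forward_integral \<alpha> f a b = forward_tail \<alpha> f a - forward_tail \<alpha> f b"

definition backward_integrable :: "real \<Rightarrow> (real \<Rightarrow> real) \<Rightarrow> real \<Rightarrow> real \<Rightarrow> bool" where
  "backward_integrable \<beta> f a b \<longleftrightarrow>
     summable (\<lambda>k. f (a - real k * \<beta>)) \<and> summable (\<lambda>k. f (b - real k * \<beta>))"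

definition backward_tail :: "real \<Rightarrow> (real \<Rightarrow> real) \<Rightarrow> real \<Rightarrow> real" where
  "backward_tail \<beta> f x = \<beta> * (\<Sum>k. f (x - real k * \<beta>))"

definition backward_integral :: "real \<Rightarrow> (real \<Rightarrow> real) \<Rightarrow> real \<Rightarrow> real \<Rightarrow> real" where
  "backward_integral \<beta> f a b = backward_tail \<beta> f b - backward_tail \<beta> f a"

definition symmetric_integrable ::
    "real \<Rightarrow> real \<Rightarrow> (real \<Rightarrow> real) \<Rightarrow> real \<Rightarrow> real \<Rightarrow> bool" where
  "symmetric_integrable \<alpha> \<beta> f a b \<longleftrightarrow>
     (\<alpha> \<noteq> 0 \<longrightarrow> forward_integrable \<alpha> f a b) \<and> (\<beta> \<noteq> 0 \<longrightarrow> backward_integrable \<beta> f a b)"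

text \<open>
  The integral is a total function; it carries its intended meaning only for functions
  satisfying \<open>symmetric_integrable\<close>, since the value of a divergent series is
  arbitrary. A term with coefficient \<open>0\<close> vanishes whatever its second factor is, so it
  needs no separate case.
\<close>

definition symmetric_integral ::
    "real \<Rightarrow> real \<Rightarrow> (real \<Rightarrow> real) \<Rightarrow> real \<Rightarrow> real \<Rightarrow> real" where
  "symmetric_integral \<alpha> \<beta> f a b =
     \<alpha> / (\<alpha> + \<beta>) * forward_integral \<alpha> f a b + \<beta> / (\<alpha> + \<beta>) * backward_integral \<beta> f a b"

text \<open>
  Integrability asks only for convergence, not absolute convergence, so it does not pass from
  \<open>f\<close> to \<open>\<bar>f\<bar>\<^sup>2\<close>: with step \<open>1\<close> from \<open>0\<close>,
  take \<open>f k = (-1)^k / sqrt (k + 1)\<close>. The integrals of squares in a Cauchy-Schwarz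
  inequality therefore need existence hypotheses of their own; the integrability of
  \<open>\<bar>f * g\<bar>\<close> then follows.
\<close>

end

theory Submission
  imports Defs "HOL-Analysis.L2_Norm"
begin

text \<open>
  Since \<open>b \<in> \<A>\<close> and \<open>a \<in> \<B>\<close>, the series starting at \<open>a\<close> and at \<open>b\<close> differ by
  finitely many terms. The symmetric integral is therefore a finite sum with nonnegative weights,
  to which the discrete Cauchy-Schwarz inequality applies. Integrability of \<open>\<bar>f g\<bar>\<close> comes
  from \<open>2 \<bar>f g\<bar> \<le> \<bar>f\<bar>\<^sup>2 + \<bar>g\<bar>\<^sup>2\<close>.
\<close>

text \<open>The series from \<open>b\<close> is the series from \<open>a\<close> without its first
  \<open>m\<close> terms. The sign of \<open>\<alpha>\<close> is left free so that the backward case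
  can use a negative step.\<close>

lemma forward_integral_eq_sum:
  assumes "forward_integrable \<alpha> h a b" and "b = a + real m * \<alpha>"
  shows "forward_integral \<alpha> h a b = (\<Sum>k<m. \<alpha> * h (a + real k * \<alpha>))"
proof -
  have "(\<Sum>k. h (a + real k * \<alpha>))
      = (\<Sum>k. h (a + real (k + m) * \<alpha>)) + (\<Sum>k<m. h (a + real k * \<alpha>))"
    using assms(1) unfolding forward_integrable_def by (intro suminf_split_initial_segment) simp
  moreover have "(\<lambda>k. h (a + real (k + m) * \<alpha>)) = (\<lambda>k. h (b + real k * \<alpha>))"
    by (simp add: assms(2) algebra_simps)
  ultimately show ?thesis
    by (simp add: forward_integral_def forward_tail_def distrib_left flip: sum_distrib_left)
qed

text \<open>A backward series with step \<open>\<beta>\<close> is a forward series with step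
  \<open>- \<beta>\<close>, the endpoints trading roles. Both sides of the forward formula then
  carry a minus sign, which cancels.\<close>

lemma backward_integral_eq_sum:
  assumes "backward_integrable \<beta> h a b" and "a = b - real n * \<beta>"
  shows "backward_integral \<beta> h a b = (\<Sum>k<n. \<beta> * h (b - real k * \<beta>))"
proof -
  have "forward_integrable (- \<beta>) h b a" and "a = b + real n * (- \<beta>)"
    using assms by (simp_all add: backward_integrable_def forward_integrable_def)
  from forward_integral_eq_sum[OF this] show ?thesis
    by (simp add: backward_integral_def forward_integral_def backward_tail_def forward_tail_def
        sum_negf)
qed

text \<open>The disjoint sum \<open><+>\<close> merges both grids into one index set, so that
  Cauchy-Schwarz applies once; a point lying on both grids is counted twice. Each square in the
  weights is the step of the grid times the coefficient of its integral.\<close>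

lemma symmetric_integral_eq_sum:
  assumes "symmetric_integrable \<alpha> \<beta> h a b"
    and "b = a + real m * \<alpha>" and "a = b - real n * \<beta>"
  shows "symmetric_integral \<alpha> \<beta> h a b
    = (\<Sum>i\<in>{..<m} <+> {..<n}. case_sum (\<lambda>_. \<alpha>\<^sup>2 / (\<alpha> + \<beta>)) (\<lambda>_. \<beta>\<^sup>2 / (\<alpha> + \<beta>)) i
        * h (case_sum (\<lambda>k. a + real k * \<alpha>) (\<lambda>k. b - real k * \<beta>) i))"
proof -
  have "\<alpha> * forward_integral \<alpha> h a b = (\<Sum>k<m. \<alpha>\<^sup>2 * h (a + real k * \<alpha>))"
  \<comment> \<open>For \<open>\<alpha> = 0\<close> nothing is known about the forward series, but
    the factor annihilates both sides.\<close>
  proof (cases "\<alpha> = 0")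
    case False
    then have "forward_integrable \<alpha> h a b"
      using assms(1) by (simp add: symmetric_integrable_def)
    from forward_integral_eq_sum[OF this assms(2)] show ?thesis
      by (simp add: sum_distrib_left power2_eq_square mult.assoc)
  qed simp
  moreover have "\<beta> * backward_integral \<beta> h a b = (\<Sum>k<n. \<beta>\<^sup>2 * h (b - real k * \<beta>))"
  proof (cases "\<beta> = 0")
    case False
    then have "backward_integrable \<beta> h a b"
      using assms(1) by (simp add: symmetric_integrable_def)
    from backward_integral_eq_sum[OF this assms(3)] show ?thesis
      by (simp add: sum_distrib_left power2_eq_square mult.assoc)
  qed simp
  ultimately show ?thesis
    by (simp add: symmetric_integral_def sum.Plus sum_divide_distrib)
qed

text \<open>Writing \<open>w i\<close> as \<open>sqrt (w i) * sqrt (w i)\<close> puts one root into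
  each factor and reduces the claim to the unweighted inequality.\<close>

lemma weighted_Cauchy_Schwarz_sum:
  fixes w f g :: "'i \<Rightarrow> real"
  assumes "\<And>i. i \<in> I \<Longrightarrow> w i \<ge> 0"
  shows "(\<Sum>i\<in>I. w i * \<bar>f i * g i\<bar>)
    \<le> sqrt ((\<Sum>i\<in>I. w i * \<bar>f i\<bar>\<^sup>2) * (\<Sum>i\<in>I. w i * \<bar>g i\<bar>\<^sup>2))"
proof -
  have "(\<Sum>i\<in>I. w i * \<bar>f i * g i\<bar>) = (\<Sum>i\<in>I. \<bar>sqrt (w i) * f i\<bar> * \<bar>sqrt (w i) * g i\<bar>)"
    using assms by (intro sum.cong) (simp_all add: abs_mult)
  also have "\<dots> \<le> L2_set (\<lambda>i. sqrt (w i) * f i) I * L2_set (\<lambda>i. sqrt (w i) * g i) I"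
    by (rule L2_set_mult_ineq)
  also have "\<dots> = sqrt ((\<Sum>i\<in>I. w i * \<bar>f i\<bar>\<^sup>2) * (\<Sum>i\<in>I. w i * \<bar>g i\<bar>\<^sup>2))"
    using assms by (simp add: L2_set_def power_mult_distrib real_sqrt_mult)
  finally show ?thesis .
qed

lemma summable_abs_mult:
  fixes f g :: "nat \<Rightarrow> real"
  assumes "summable (\<lambda>k. \<bar>f k\<bar>\<^sup>2)" and "summable (\<lambda>k. \<bar>g k\<bar>\<^sup>2)"
  shows "summable (\<lambda>k. \<bar>f k * g k\<bar>)"
proof (rule summable_comparison_test'[OF summable_add[OF assms]])
  fix k
  have "2 * \<bar>f k\<bar> * \<bar>g k\<bar> \<le> \<bar>f k\<bar>\<^sup>2 + \<bar>g k\<bar>\<^sup>2"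
    by (rule sum_squares_bound)
  \<comment> \<open>Nonnegativity allows the factor 2 in the previous bound to be dropped.\<close>
  moreover have "0 \<le> \<bar>f k\<bar> * \<bar>g k\<bar>"
    by simp
  ultimately show "norm \<bar>f k * g k\<bar> \<le> \<bar>f k\<bar>\<^sup>2 + \<bar>g k\<bar>\<^sup>2"
    unfolding real_norm_def abs_abs abs_mult by linarith
qed

lemma symmetric_integrable_abs_mult:
  assumes "symmetric_integrable \<alpha> \<beta> (\<lambda>t. \<bar>f t\<bar>\<^sup>2) a b"
    and "symmetric_integrable \<alpha> \<beta> (\<lambda>t. \<bar>g t\<bar>\<^sup>2) a b"
  shows "symmetric_integrable \<alpha> \<beta> (\<lambda>t. \<bar>f t * g t\<bar>) a b"
  using assms
  unfolding symmetric_integrable_def forward_integrable_def backward_integrable_def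
  by (auto intro!: summable_abs_mult)

theorem corollary5p3p18:
  fixes \<alpha> \<beta> a b :: real and f g :: "real \<Rightarrow> real"
  assumes "\<alpha> \<ge> 0" and "\<beta> \<ge> 0" and "\<alpha> + \<beta> \<noteq> 0"
    and "a < b"
    and "b \<in> range (\<lambda>k::nat. a + real k * \<alpha>)"
    and "a \<in> range (\<lambda>k::nat. b - real k * \<beta>)"
    and "symmetric_integrable \<alpha> \<beta> f a b"
    and "symmetric_integrable \<alpha> \<beta> g a b"
    and "symmetric_integrable \<alpha> \<beta> (\<lambda>t. \<bar>f t\<bar>\<^sup>2) a b"
    and "symmetric_integrable \<alpha> \<beta> (\<lambda>t. \<bar>g t\<bar>\<^sup>2) a b"
  shows "symmetric_integrable \<alpha> \<beta> (\<lambda>t. \<bar>f t * g t\<bar>) a b \<and>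
    symmetric_integral \<alpha> \<beta> (\<lambda>t. \<bar>f t * g t\<bar>) a b
      \<le> sqrt (symmetric_integral \<alpha> \<beta> (\<lambda>t. \<bar>f t\<bar>\<^sup>2) a b
               * symmetric_integral \<alpha> \<beta> (\<lambda>t. \<bar>g t\<bar>\<^sup>2) a b)"
proof
  show fg: "symmetric_integrable \<alpha> \<beta> (\<lambda>t. \<bar>f t * g t\<bar>) a b"
    using assms(9,10) by (rule symmetric_integrable_abs_mult)
  obtain m n :: nat where mn: "b = a + real m * \<alpha>" "a = b - real n * \<beta>"
    using assms(5,6) by blast
  show "symmetric_integral \<alpha> \<beta> (\<lambda>t. \<bar>f t * g t\<bar>) a b
      \<le> sqrt (symmetric_integral \<alpha> \<beta> (\<lambda>t. \<bar>f t\<bar>\<^sup>2) a b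
               * symmetric_integral \<alpha> \<beta> (\<lambda>t. \<bar>g t\<bar>\<^sup>2) a b)"
    \<comment> \<open>The same \<open>m\<close> and \<open>n\<close> serve all three integrands, so
      the three sums share index set, nodes and weights.\<close>
    unfolding symmetric_integral_eq_sum[OF fg mn] symmetric_integral_eq_sum[OF assms(9) mn]
      symmetric_integral_eq_sum[OF assms(10) mn]
    using assms(1,2) by (intro weighted_Cauchy_Schwarz_sum) (auto split: sum.split)
qed

end
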